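(* Let $R$ be a commutative ring with $1\neq 0$, let $\alpha\in\{\text{atomic},\ \text{strongly atomic},\ \text{m-atomic},\ \text{very strongly atomic}\}$ and $\beta\in\{\text{associate},\ \text{strong associate},\ \text{very strong associate}\}$. Then the following are equivalent for any (hence all) choices of $\alpha$ and $\beta$. (1) $R$ is a $\beta$-FFR. (2) $R$ is a BFR and a $\beta$-WFFR. (3) $R$ is présimplifiable and a $\beta$-WFFR. (4) $R$ is a BFR and an $\alpha$-$\beta$-divisor finite ring. (5) $R$ is présimplifiable and an $\alpha$-$\beta$-divisor finite ring. (6) For all non-units $x\in R$, $\sum_{a\in V(G_\emptyset^\beta(x))}\mathrm{degl}(a)<\infty$. (7) For all non-units $x\in R$, $|E(G_\emptyset^\beta(x))|<\infty$. (8) $R$ is a BFR and for all $x\in R$ not a unit, $|V(G_\emptyset^\beta(x))|<\infty$. (9) $R$ is présimplifiable and for all $x\in R$ not a unit, $|V(G_\emptyset^\beta(x))|<\infty$. (10) $R$ is a BFR and for all $x\in R$ not a unit, $|V(G_\alpha^\beta(x))|<\infty$. (11) $R$ is présimplifiable and for all $x\in R$ not a unit, $|V(G_\alpha^\beta(x))|<\infty$.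
   Context: $U(R)$ is the group of units of $R$. $R$ is présimplifiable if $x=xy$ implies $x=0$ or $y\in U(R)$. For $a,b\in R$: $a,b$ are associates, $a\sim b$, if $(a)=(b)$; strong associates, $a\approx b$, if $a=\lambda b$ for some $\lambda\in U(R)$; very strong associates, $a\cong b$, if $a\sim b$ and either $a=b=0$ or ($a=rb$ with $r\in R$ implies $r\in U(R)$). A non-unit $a\in R$ is: irreducible (atomic) if $a=bc$ implies $a\sim b$ or $a\sim c$; strongly irreducible (strongly atomic) if $a=bc$ implies $a\approx b$ or $a\approx c$; m-irreducible (m-atomic) if $(a)$ is maximal among the proper principal ideals of $R$; very strongly irreducible (very strongly atomic) if $a=bc$ implies $a\cong b$ or $a\cong c$. A factorization of a non-unit $x$ is an expression $x=a_1\cdots a_n$, $n\ge1$, with every $a_i$ a non-unit; it is an $\alpha$-factorization if every $a_i$ is $\alpha$. $R$ is a: bounded factorization ring (BFR) if for every non-unit $a$ there is a natural number $N(a)$ with $n\le N(a)$ for every factorization $a=a_1\cdots a_n$; $\beta$-finite factorization ring ($\beta$-FFR) if every non-unit has only a finite number of factorizations up to rearrangement and $\beta$; $\beta$-weak finite factorization ring ($\beta$-WFFR) if every non-unit has only finitely many divisors up to $\beta$; $\alpha$-$\beta$-divisor finite ring if every non-unit has only finitely many $\alpha$ divisors up to $\beta$. Divisor graphs: let $A_\emptyset(R)=R\setminus U(R)$ and let $A_\alpha(R)$ be the set of non-units that are $\alpha$. For $\gamma\in\{\emptyset,\alpha\}$ let $A_\gamma^\beta(R)$ be a fixed set of representatives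 of $A_\gamma(R)$ up to $\beta$. For a non-unit $x$, $V(G_\gamma^\beta(x))=\{a\in A_\gamma^\beta(R): a\mid x\}$. Distinct vertices $a,b$ are joined by an edge iff there is a $\gamma$-factorization (an ordinary factorization if $\gamma=\emptyset$) of the form $x=ab\,a_1\cdots a_m$, $m\ge0$. A vertex $a$ carries $n-1$ loops if there is a $\gamma$-factorization of the form $x=a^n a_1\cdots a_m$ ($m\ge0$, $n$ as large as possible), and infinitely many loops if arbitrarily large powers of $a$ divide $x$. The edge set $E$ includes loops. $\deg(a)$ is the number of vertices different from $a$ adjacent to $a$; $\mathrm{degl}(a)$ is $\deg(a)$ plus the number of loops at $a$.
   Formalization: Zero is excluded from the non-units x in every condition; (5) and (11) also require every nonzero non-unit to have an α-factorization; edges and loops in the divisor graphs use factorizations of x up to a unit factor. The printed statement is false without these changes. *)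

theory Defs
  imports "HOL-Analysis.Analysis" "HOL-Library.Multiset"
begin

text \<open>
  The ring \<open>R\<close> is a type of class \<^class>\<open>comm_ring_1\<close>, which includes \<open>0 \<noteq> 1\<close>.
  Properties of the ring itself take an argument of type \<open>'a itself\<close>.

  Zero is a non-unit, and it is allowed as a factor, as a vertex and as an atom. The finiteness
  conditions, however, only range over the nonzero non-units: since \<open>0 = 0 * \<dots> * 0\<close> with any
  number of factors, no ring would otherwise be a bounded factorization ring.
\<close>

definition units :: "'a::comm_ring_1 set" where
  "units = {a. a dvd 1}"

definition nonunits :: "'a::comm_ring_1 set" where
  "nonunits = - units"

definition presimplifiable :: "'a::comm_ring_1 itself \<Rightarrow> bool" where
  "presimplifiable _ \<longleftrightarrow> (\<forall>x y :: 'a. x = x * y \<longrightarrow> x = 0 \<or> y \<in> units)"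

definition principal :: "'a::comm_ring_1 \<Rightarrow> 'a set" where
  "principal a = {r * a | r. True}"


subsection \<open>Associate relations\<close>

definition associates :: "'a::comm_ring_1 \<Rightarrow> 'a \<Rightarrow> bool" where
  "associates a b \<longleftrightarrow> principal a = principal b"

definition strong_associates :: "'a::comm_ring_1 \<Rightarrow> 'a \<Rightarrow> bool" where
  "strong_associates a b \<longleftrightarrow> (\<exists>u\<in>units. a = u * b)"

definition very_strong_associates :: "'a::comm_ring_1 \<Rightarrow> 'a \<Rightarrow> bool" where
  "very_strong_associates a b \<longleftrightarrow>
     associates a b \<and> (a = 0 \<and> b = 0 \<or> (\<forall>r. a = r * b \<longrightarrow> r \<in> units))"

datatype assoc_kind = Associate | Strong_Associate | Very_Strong_Associate

fun assoc_rel :: "assoc_kind \<Rightarrow> 'a::comm_ring_1 \<Rightarrow> 'a \<Rightarrow> bool" where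
  "assoc_rel Associate = associates"
| "assoc_rel Strong_Associate = strong_associates"
| "assoc_rel Very_Strong_Associate = very_strong_associates"

text \<open>
  Being very strong associates is symmetric and transitive but not reflexive in general (a nonzero
  idempotent non-unit is not a very strong associate of itself). Identification \<open>up to \<beta>\<close>
  therefore refers to the reflexive closure; for the other two relations this changes nothing.
\<close>

definition same :: "assoc_kind \<Rightarrow> 'a::comm_ring_1 \<Rightarrow> 'a \<Rightarrow> bool" where
  "same \<beta> a b \<longleftrightarrow> a = b \<or> assoc_rel \<beta> a b"

definition finite_up_to :: "('b \<Rightarrow> 'b \<Rightarrow> bool) \<Rightarrow> 'b set \<Rightarrow> bool" where
  "finite_up_to eq X \<longleftrightarrow> (\<exists>F\<subseteq>X. finite F \<and> (\<forall>x\<in>X. \<exists>y\<in>F. eq x y))"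

definition representatives :: "assoc_kind \<Rightarrow> 'a::comm_ring_1 set \<Rightarrow> 'a set \<Rightarrow> bool" where
  "representatives \<beta> A S \<longleftrightarrow> S \<subseteq> A \<and> (\<forall>a\<in>A. \<exists>!s. s \<in> S \<and> same \<beta> a s)"


subsection \<open>Irreducible elements\<close>

datatype atom_kind = Atomic | Strongly_Atomic | M_Atomic | Very_Strongly_Atomic

fun atoms :: "atom_kind \<Rightarrow> 'a::comm_ring_1 set" where
  "atoms Atomic =
     {a \<in> nonunits. \<forall>b c. a = b * c \<longrightarrow> associates a b \<or> associates a c}"
| "atoms Strongly_Atomic =
     {a \<in> nonunits. \<forall>b c. a = b * c \<longrightarrow> strong_associates a b \<or> strong_associates a c}"
| "atoms M_Atomic =
     {a \<in> nonunits. \<forall>b. principal b \<noteq> UNIV \<and> principal a \<subseteq> principal b \<longrightarrow>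
                        principal b = principal a}"
| "atoms Very_Strongly_Atomic =
     {a \<in> nonunits. \<forall>b c. a = b * c \<longrightarrow>
                        very_strong_associates a b \<or> very_strong_associates a c}"


subsection \<open>Factorizations\<close>

text \<open>
  The set \<open>A\<close> of admitted factors is either \<^const>\<open>nonunits\<close> (ordinary factorizations) or
  \<open>atoms \<alpha>\<close> (\<open>\<alpha>\<close>-factorizations).
\<close>

definition factorizations :: "'a::comm_ring_1 set \<Rightarrow> 'a \<Rightarrow> 'a list set" where
  "factorizations A x = {fs. fs \<noteq> [] \<and> set fs \<subseteq> A \<and> prod_list fs = x}"

definition BFR :: "'a::comm_ring_1 itself \<Rightarrow> bool" where
  "BFR _ \<longleftrightarrow> (\<forall>x \<in> nonunits - {0 :: 'a}.
     \<exists>N. \<forall>fs \<in> factorizations nonunits x. length fs \<le> N)"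

definition FFR :: "assoc_kind \<Rightarrow> 'a::comm_ring_1 itself \<Rightarrow> bool" where
  "FFR \<beta> _ \<longleftrightarrow> (\<forall>x \<in> nonunits - {0 :: 'a}.
     finite_up_to (\<lambda>fs gs. rel_mset (same \<beta>) (mset fs) (mset gs)) (factorizations nonunits x))"

definition WFFR :: "assoc_kind \<Rightarrow> 'a::comm_ring_1 itself \<Rightarrow> bool" where
  "WFFR \<beta> _ \<longleftrightarrow> (\<forall>x \<in> nonunits - {0 :: 'a}. finite_up_to (same \<beta>) {a. a dvd x})"

definition divisor_finite :: "atom_kind \<Rightarrow> assoc_kind \<Rightarrow> 'a::comm_ring_1 itself \<Rightarrow> bool" where
  "divisor_finite \<alpha> \<beta> _ \<longleftrightarrow>
     (\<forall>x \<in> nonunits - {0 :: 'a}. finite_up_to (same \<beta>) {a \<in> atoms \<alpha>. a dvd x})"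

text \<open>
  Divisor-finiteness is vacuous in a ring without atoms. For instance a valuation domain with value
  group the rationals is presimplifiable and has no atoms, but it is not a bounded
  factorization ring. Where no other condition provides atomic factorizations, their existence
  has to be required separately, as in the classical characterization of
  finite factorization domains as the atomic domains whose nonzero elements have finitely many
  irreducible divisors.
\<close>

definition has_atomic_factorizations :: "atom_kind \<Rightarrow> 'a::comm_ring_1 itself \<Rightarrow> bool" where
  "has_atomic_factorizations \<alpha> _ \<longleftrightarrow>
     (\<forall>x \<in> nonunits - {0 :: 'a}. factorizations (atoms \<alpha>) x \<noteq> {})"


subsection \<open>Divisor graphs\<close>

text \<open>
  \<open>A\<close> is the set of admitted factors as above and \<open>S\<close> the fixed set of representatives of \<open>A\<close>.
  As vertices are only chosen up to associates, a factorization \<open>x = a * b * \<dots>\<close> is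
  understood up to a unit, that is, as one of \<open>u * x\<close> for some unit \<open>u\<close>. Otherwise the graph would
  depend on the choice of \<open>S\<close>: in the integers, with positive representatives, \<open>-6\<close> has no
  factorization of the form \<open>2 * 3 * \<dots>\<close> into non-units.
\<close>

definition vertices :: "'a::comm_ring_1 set \<Rightarrow> 'a \<Rightarrow> 'a set" where
  "vertices S x = {a \<in> S. a dvd x}"

definition adjacent :: "'a::comm_ring_1 set \<Rightarrow> 'a set \<Rightarrow> 'a \<Rightarrow> 'a \<Rightarrow> 'a \<Rightarrow> bool" where
  "adjacent A S x a b \<longleftrightarrow>
     a \<in> vertices S x \<and> b \<in> vertices S x \<and> a \<noteq> b \<and>
     (\<exists>u\<in>units. \<exists>as. a # b # as \<in> factorizations A (u * x))"

text \<open>If no factorization involves \<open>a\<close>, then the supremum below is \<open>0\<close> and there is no loop.\<close>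

definition loops :: "'a::comm_ring_1 set \<Rightarrow> 'a \<Rightarrow> 'a \<Rightarrow> enat" where
  "loops A x a =
     (if \<forall>N. \<exists>n\<ge>N. a ^ n dvd x then \<infinity>
      else enat (Sup {n. \<exists>u\<in>units. \<exists>as. replicate n a @ as \<in> factorizations A (u * x)} - 1))"

datatype 'a edge = Edge "'a set" | Loop 'a nat

definition edges :: "'a::comm_ring_1 set \<Rightarrow> 'a set \<Rightarrow> 'a \<Rightarrow> 'a edge set" where
  "edges A S x =
     {Edge {a, b} | a b. adjacent A S x a b} \<union>
     {Loop a k | a k. a \<in> vertices S x \<and> enat k < loops A x a}"

definition deg :: "'a::comm_ring_1 set \<Rightarrow> 'a set \<Rightarrow> 'a \<Rightarrow> 'a \<Rightarrow> enat" where
  "deg A S x a =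
     (let N = {b. adjacent A S x a b} in if finite N then enat (card N) else \<infinity>)"

definition degl :: "'a::comm_ring_1 set \<Rightarrow> 'a set \<Rightarrow> 'a \<Rightarrow> 'a \<Rightarrow> enat" where
  "degl A S x a = deg A S x a + loops A x a"

end

theory Submission
  imports Defs
begin

text \<open>
  Each of the eleven conditions, for every choice of \<open>\<alpha>\<close> and \<open>\<beta>\<close>, is equivalent to one and the same
  property \<open>finitely_many_principal_divisors\<close>: the ring is presimplifiable, and every nonzero
  non-unit is divisible by only finitely many elements up to associates, that is, its divisors
  generate only finitely many principal ideals. This property mentions neither \<open>\<alpha>\<close> nor \<open>\<beta>\<close>, so the
  independence of the choices comes for free.

  In a presimplifiable ring the three associate relations are all equality of principal ideals
  (\<open>presimplifiable_assoc_rel\<close>). Thus finiteness up to \<open>\<beta>\<close>, and finiteness of a vertex set,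
  become finiteness of a set of principal ideals. The argument is uniform in the kind of atoms:
  given atoms enter as non-units, and where atoms have to be produced, they are elements that
  cannot be split into two non-units, and these are atoms of every kind
  (\<open>unsplittable_imp_atom\<close>).

  Every condition forces the ring to be presimplifiable. If \<open>x = x * y\<close> with \<open>x \<noteq> 0\<close> and a non-unit
  \<open>y\<close>, then all powers of \<open>y\<close> divide \<open>x\<close>. So \<open>x\<close> has arbitrarily long factorizations
  (\<open>BFR_imp_presimplifiable\<close>), and the vertex representing \<open>y\<close> in the graph of \<open>x\<close> carries
  infinitely many loops (\<open>infinitely_many_loops\<close>).

  Given finitely many principal divisors, the partial products of a factorization generate distinct
  principal ideals, so factorizations are bounded (\<open>finite_divisors_imp_BFR\<close>); all the finiteness
  conditions follow. In a bounded factorization ring the longest factorizations consist of atoms.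

  The converse is easy for the conditions on the full graph, because every vertex that is not
  an associate of \<open>x\<close> has a neighbour or a loop (\<open>adjacent_or_loop\<close>). For the conditions on
  atoms it rests on Dickson's lemma: viewed as multisets of representatives of the finitely many
  atoms that divide \<open>x\<close>, the factorizations of \<open>x\<close> form an antichain under inclusion, because
  cancelling a sub-factorization leaves a product of non-units that is a unit. So they are finitely
  many, and up to associates all divisors of \<open>x\<close> are partial products of them
  (\<open>atomic_divisor_finite_imp_finite_divisors\<close>).
\<close>

section \<open>Units and principal ideals\<close>

lemma units_mult_iff: "a * b \<in> units \<longleftrightarrow> a \<in> units \<and> b \<in> units"
  using mult_dvd_mono[of a 1 b 1] by (auto simp: units_def dest: dvd_mult_left dvd_mult_right)

lemma one_in_units: "1 \<in> units"
  by (simp add: units_def)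

lemma nonunits_iff: "a \<in> nonunits \<longleftrightarrow> a \<notin> units"
  by (simp add: nonunits_def)

lemma principal_alt: "principal a = {b. a dvd b}"
  by (auto simp: principal_def dvd_def mult.commute)

lemma principal_eq_iff: "principal a = principal b \<longleftrightarrow> a dvd b \<and> b dvd a"
proof
  assume "principal a = principal b"
  then have "a \<in> principal b \<and> b \<in> principal a"
    using dvd_refl unfolding principal_alt by blast
  then show "a dvd b \<and> b dvd a"
    unfolding principal_alt by blast
next
  assume "a dvd b \<and> b dvd a"
  then show "principal a = principal b"
    unfolding principal_alt using dvd_trans by blast
qed

lemma principal_eq_UNIV_iff: "principal a = UNIV \<longleftrightarrow> a \<in> units"
proof
  assume "principal a = UNIV"
  then have "1 \<in> principal a" by simp
  then show "a \<in> units" by (simp add: principal_alt units_def)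
next
  assume "a \<in> units"
  then have "a dvd b" for b
    using dvd_trans[of a 1 b] by (simp add: units_def)
  then show "principal a = UNIV"
    by (auto simp: principal_alt)
qed

lemma principal_mult_cong:
  "principal a = principal a' \<Longrightarrow> principal b = principal b' \<Longrightarrow> principal (a * b) = principal (a' * b')"
  by (simp add: principal_eq_iff mult_dvd_mono)

lemma principal_mult_unit: "u \<in> units \<Longrightarrow> principal (a * u) = principal a"
  using principal_mult_cong[of a a u 1] by (simp add: principal_eq_iff units_def)

lemma dvd_prod_list: "(a :: 'a::comm_monoid_mult) \<in> set xs \<Longrightarrow> a dvd prod_list xs"
  by (induction xs) auto

lemma prod_list_in_units_imp: "prod_list xs \<in> units \<Longrightarrow> a \<in> set xs \<Longrightarrow> a \<in> units"
  unfolding units_def using dvd_prod_list dvd_trans by blast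

lemma associates_imp_dvd: "associates a b \<Longrightarrow> a dvd b \<and> b dvd a"
  by (simp add: associates_def principal_eq_iff)

lemma strong_associates_imp_associates: "strong_associates a b \<Longrightarrow> associates a b"
  unfolding strong_associates_def associates_def
  by (metis mult.commute principal_mult_unit)

lemma same_imp_associates: "same \<beta> a b \<Longrightarrow> associates a b"
  by (cases \<beta>; cases "a = b")
    (auto simp: same_def very_strong_associates_def associates_def
      dest: strong_associates_imp_associates[unfolded associates_def])


section \<open>Presimplifiable rings\<close>

lemma presimplifiableD:
  "presimplifiable TYPE('a::comm_ring_1) \<Longrightarrow> (x :: 'a) = x * y \<Longrightarrow> x \<noteq> 0 \<Longrightarrow> y \<in> units"
  unfolding presimplifiable_def by blast

lemma presimplifiable_dvd_mult:
  assumes "presimplifiable TYPE('a::comm_ring_1)" "(x :: 'a) * y dvd x" "x \<noteq> 0"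
  shows "y \<in> units"
proof -
  obtain t where "x = x * (y * t)"
    using assms(2) by (auto simp: dvd_def mult.assoc)
  then have "y * t \<in> units"
    using presimplifiableD assms by blast
  then show ?thesis by (simp add: units_mult_iff)
qed

text \<open>
  If \<open>a\<close> and \<open>b\<close> divide each other, the product of the two cofactors fixes \<open>a\<close>; so in a
  presimplifiable ring both cofactors are units, which is all that the stronger relations ask for.
\<close>

lemma presimplifiable_assoc_rel:
  assumes pres: "presimplifiable TYPE('a::comm_ring_1)"
  shows "assoc_rel \<beta> = (associates :: 'a \<Rightarrow> 'a \<Rightarrow> bool)"
proof -
  have cofactor: "r \<in> units" if ab: "associates a b" and "a \<noteq> 0" "a = r * b" for a b r :: 'a
  proof -
    obtain s where s: "b = a * s"
      using associates_imp_dvd[OF ab] by (auto simp: dvd_def)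
    have "a = a * (r * s)"
      using \<open>a = r * b\<close> s by (metis mult.left_commute)
    then show ?thesis
      using presimplifiableD[OF pres _ \<open>a \<noteq> 0\<close>] units_mult_iff by blast
  qed
  have strong: "strong_associates a b" if ab: "associates a b" for a b :: 'a
  proof (cases "a = 0")
    case True
    then have "b = 0"
      using associates_imp_dvd[OF ab] by simp
    with True show ?thesis
      using one_in_units by (auto simp: strong_associates_def)
  next
    case False
    obtain r where "a = r * b"
      using associates_imp_dvd[OF ab] by (auto simp: dvd_def mult.commute)
    with cofactor[OF ab False] show ?thesis
      by (auto simp: strong_associates_def)
  qed
  have very_strong: "very_strong_associates a b" if ab: "associates a b" for a b :: 'a
  proof (cases "a = 0")
    case True
    then have "b = 0"
      using associates_imp_dvd[OF ab] by simp
    with True ab show ?thesis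
      by (simp add: very_strong_associates_def)
  next
    case False
    then show ?thesis
      using ab cofactor[OF ab False] by (simp add: very_strong_associates_def)
  qed
  have "assoc_rel \<beta> a b \<longleftrightarrow> associates a b" for a b :: 'a
  proof
    show "assoc_rel \<beta> a b \<Longrightarrow> associates a b"
      using same_imp_associates[of \<beta> a b] by (simp add: same_def)
    show "associates a b \<Longrightarrow> assoc_rel \<beta> a b"
      by (cases \<beta>) (simp_all add: strong very_strong)
  qed
  then show ?thesis by blast
qed

lemma presimplifiable_same:
  assumes "presimplifiable TYPE('a::comm_ring_1)"
  shows "same \<beta> = (associates :: 'a \<Rightarrow> 'a \<Rightarrow> bool)"
  by (intro ext) (auto simp: same_def presimplifiable_assoc_rel[OF assms] associates_def)

text \<open>
  An element without proper factors is an atom of every kind, as in each definition one of the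
  two factors is a unit and then the other one is an associate.
\<close>

lemma unsplittable_imp_atom:
  assumes pres: "presimplifiable TYPE('a::comm_ring_1)"
    and a: "(a :: 'a) \<in> nonunits"
    and split: "\<And>b c. a = b * c \<Longrightarrow> b \<in> units \<or> c \<in> units"
  shows "a \<in> atoms \<alpha>"
proof -
  have rel: "assoc_rel \<beta> a b \<or> assoc_rel \<beta> a c" if bc: "a = b * c" for \<beta> b c
    using split[OF bc]
  proof
    assume "c \<in> units"
    then show ?thesis
      by (simp add: bc presimplifiable_assoc_rel[OF pres] associates_def principal_mult_unit)
  next
    assume "b \<in> units"
    then have "principal (c * b) = principal c"
      by (rule principal_mult_unit)
    then show ?thesis
      by (simp add: bc presimplifiable_assoc_rel[OF pres] associates_def mult.commute)
  qed
  show ?thesis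
  proof (cases \<alpha>)
    case M_Atomic
    have "principal b = principal a" if b: "principal b \<noteq> UNIV" "principal a \<subseteq> principal b" for b
    proof -
      have "b dvd a"
        using b(2) dvd_refl[of a] unfolding principal_alt by blast
      then obtain c where c: "a = b * c" by (auto simp: dvd_def)
      then have "c \<in> units"
        using split[OF c] b(1) by (simp add: principal_eq_UNIV_iff)
      then show ?thesis
        by (simp add: c principal_mult_unit)
    qed
    with M_Atomic a show ?thesis by simp
  next
    case Atomic
    then show ?thesis using a rel[where \<beta> = Associate] by auto
  next
    case Strongly_Atomic
    then show ?thesis using a rel[where \<beta> = Strong_Associate] by auto
  next
    case Very_Strongly_Atomic
    then show ?thesis using a rel[where \<beta> = Very_Strong_Associate] by auto
  qed
qed

lemma atoms_subset_nonunits: "atoms \<alpha> \<subseteq> nonunits"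
  by (cases \<alpha>) auto


section \<open>Finiteness up to associates as finiteness of sets of principal ideals\<close>

lemma finite_image_imp_finite_up_to:
  assumes "finite (f ` X)" and eq: "\<And>x y. x \<in> X \<Longrightarrow> y \<in> X \<Longrightarrow> f x = f y \<Longrightarrow> eq x y"
  shows "finite_up_to eq X"
proof -
  obtain F where F: "F \<subseteq> X" "finite F" "f ` X = f ` F"
    using finite_subset_image[OF assms(1) subset_refl] by auto
  have "\<exists>y\<in>F. eq x y" if "x \<in> X" for x
  proof -
    have "f x \<in> f ` F"
      using that by (simp flip: F(3))
    then obtain y where y: "y \<in> F" "f x = f y" by auto
    have "eq x y"
      using y F(1) that by (intro eq) auto
    with y(1) show ?thesis ..
  qed
  with F(1,2) show ?thesis unfolding finite_up_to_def by auto
qed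

lemma finite_up_to_associates_iff: "finite_up_to associates X \<longleftrightarrow> finite (principal ` X)"
proof
  assume "finite_up_to associates X"
  then obtain F where F: "finite F" "\<forall>x\<in>X. \<exists>y\<in>F. associates x y"
    unfolding finite_up_to_def by blast
  then have "principal ` X \<subseteq> principal ` F"
    unfolding associates_def by blast
  then show "finite (principal ` X)"
    using F(1) finite_surj by blast
next
  assume "finite (principal ` X)"
  then show "finite_up_to associates X"
    by (rule finite_image_imp_finite_up_to) (simp add: associates_def)
qed

lemma inj_on_principal_vertices:
  assumes pres: "presimplifiable TYPE('a::comm_ring_1)"
    and S: "representatives \<beta> A (S :: 'a set)"
  shows "inj_on principal (vertices S x)"
proof (rule inj_onI)
  fix a b assume ab: "a \<in> vertices S x" "b \<in> vertices S x" "principal a = principal b"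
  then have "a \<in> A" "a \<in> S" "b \<in> S"
    using S by (auto simp: vertices_def representatives_def)
  moreover have "same \<beta> a a" "same \<beta> a b"
    using ab presimplifiable_same[OF pres] by (auto simp: associates_def)
  ultimately show "a = b"
    using S unfolding representatives_def by blast
qed

lemma finite_vertices_iff:
  assumes pres: "presimplifiable TYPE('a::comm_ring_1)"
    and S: "representatives \<beta> A (S :: 'a set)"
  shows "finite (vertices S x) \<longleftrightarrow> finite (principal ` {a \<in> A. a dvd x})"
proof -
  have "principal ` vertices S x = principal ` {a \<in> A. a dvd x}"
  proof
    show "principal ` vertices S x \<subseteq> principal ` {a \<in> A. a dvd x}"
      using S by (auto simp: vertices_def representatives_def)
    show "principal ` {a \<in> A. a dvd x} \<subseteq> principal ` vertices S x"
    proof clarify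
      fix a assume a: "a \<in> A" "a dvd x"
      then obtain s where s: "s \<in> S" "same \<beta> a s"
        using S unfolding representatives_def by blast
      have "associates a s"
        using s(2) by (rule same_imp_associates)
      then have "s \<in> vertices S x" "principal a = principal s"
        using s(1) a(2) associates_imp_dvd dvd_trans
        by (auto simp: vertices_def associates_def principal_eq_iff)
      then show "principal a \<in> principal ` vertices S x" by blast
    qed
  qed
  then show ?thesis
    using finite_image_iff[OF inj_on_principal_vertices[OF pres S]] by metis
qed

text \<open>The units among the divisors only contribute the unit ideal.\<close>

lemma finite_principal_nonunit_divisors_iff:
  "finite (principal ` {a \<in> nonunits. a dvd x}) \<longleftrightarrow> finite (principal ` {a. a dvd x})"
proof
  assume fin: "finite (principal ` {a \<in> nonunits. a dvd x})"
  have "principal ` {a. a dvd x} \<subseteq> insert UNIV (principal ` {a \<in> nonunits. a dvd x})"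
  proof clarify
    fix a assume a: "a dvd x" "principal a \<notin> principal ` {a \<in> nonunits. a dvd x}"
    then have "a \<in> units"
      using nonunits_iff by blast
    then show "principal a = UNIV"
      by (simp add: principal_eq_UNIV_iff)
  qed
  then show "finite (principal ` {a. a dvd x})"
    using fin finite_subset by blast
next
  assume "finite (principal ` {a. a dvd x})"
  then show "finite (principal ` {a \<in> nonunits. a dvd x})"
    by (rule rev_finite_subset) auto
qed

definition finitely_many_principal_divisors :: "'a::comm_ring_1 itself \<Rightarrow> bool" where
  "finitely_many_principal_divisors _ \<longleftrightarrow> presimplifiable TYPE('a) \<and>
     (\<forall>x \<in> nonunits - {0 :: 'a}. finite (principal ` {a. a dvd x}))"

lemma WFFR_iff_finite_divisors:
  assumes "presimplifiable TYPE('a::comm_ring_1)"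
  shows "WFFR \<beta> TYPE('a) \<longleftrightarrow> finitely_many_principal_divisors TYPE('a)"
  using assms
  by (simp add: WFFR_def finitely_many_principal_divisors_def presimplifiable_same
      finite_up_to_associates_iff)

lemma divisor_finite_iff:
  assumes "presimplifiable TYPE('a::comm_ring_1)"
  shows "divisor_finite \<alpha> \<beta> TYPE('a) \<longleftrightarrow>
    (\<forall>x \<in> nonunits - {0 :: 'a}. finite (principal ` {a \<in> atoms \<alpha>. a dvd x}))"
  using assms
  by (simp add: divisor_finite_def presimplifiable_same finite_up_to_associates_iff)

lemma finite_nonunit_vertices_iff_finite_divisors:
  assumes "presimplifiable TYPE('a::comm_ring_1)" "representatives \<beta> nonunits (S :: 'a set)"
  shows "(\<forall>x \<in> nonunits - {0}. finite (vertices S x)) \<longleftrightarrow> finitely_many_principal_divisors TYPE('a)"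
  using assms
  by (simp add: finite_vertices_iff finite_principal_nonunit_divisors_iff
      finitely_many_principal_divisors_def)

lemma finite_atom_vertices_iff_divisor_finite:
  assumes "presimplifiable TYPE('a::comm_ring_1)" "representatives \<beta> (atoms \<alpha>) (T :: 'a set)"
  shows "(\<forall>x \<in> nonunits - {0}. finite (vertices T x)) \<longleftrightarrow> divisor_finite \<alpha> \<beta> TYPE('a)"
  using assms by (simp add: finite_vertices_iff divisor_finite_iff)


section \<open>Bounded factorization rings\<close>

lemma BFR_imp_presimplifiable:
  assumes "BFR TYPE('a::comm_ring_1)"
  shows "presimplifiable TYPE('a)"
  unfolding presimplifiable_def
proof (intro allI impI)
  fix x y :: 'a assume xy: "x = x * y"
  show "x = 0 \<or> y \<in> units"
  proof (rule ccontr)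
    assume neg: "\<not> (x = 0 \<or> y \<in> units)"
    have "x \<in> nonunits"
      using neg xy units_mult_iff nonunits_iff by metis
    then obtain N where N: "\<And>fs. fs \<in> factorizations nonunits x \<Longrightarrow> length fs \<le> N"
      using assms neg unfolding BFR_def by blast
    have "x * y ^ n = x" for n
      using xy by (induction n) (auto simp: mult.assoc[symmetric])
    then have "x # replicate N y \<in> factorizations nonunits x"
      using neg \<open>x \<in> nonunits\<close> by (auto simp: factorizations_def nonunits_iff)
    with N show False by force
  qed
qed

text \<open>
  Two partial products of a factorization cannot be associates, since the factors between them would
  then have to be units. So a factorization is not longer than the number of principal ideals
  generated by divisors.
\<close>

lemma finite_divisors_imp_BFR:
  assumes "finitely_many_principal_divisors TYPE('a::comm_ring_1)"
  shows "BFR TYPE('a)"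
  unfolding BFR_def
proof (rule ballI)
  have pres: "presimplifiable TYPE('a)"
    using assms by (simp add: finitely_many_principal_divisors_def)
  fix x :: 'a assume x: "x \<in> nonunits - {0}"
  let ?D = "principal ` {a. a dvd x}"
  have fin: "finite ?D"
    using assms x by (simp add: finitely_many_principal_divisors_def)
  have "length fs \<le> card ?D" if fs: "fs \<in> factorizations nonunits x" for fs
  proof -
    let ?p = "\<lambda>i. prod_list (take i fs)"
    have p_dvd: "?p i dvd x" for i
    proof -
      have "x = ?p i * prod_list (drop i fs)"
        using fs by (simp add: factorizations_def flip: prod_list.append)
      then show ?thesis by (metis dvd_triv_left)
    qed
    have distinct: "principal (?p i) \<noteq> principal (?p j)" if ij: "i < j" "j \<le> length fs" for i j
    proof
      assume eq: "principal (?p i) = principal (?p j)"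
      have nth: "fs ! i # take (j - Suc i) (drop (Suc i) fs) = take (j - i) (drop i fs)"
        using ij by (metis Cons_nth_drop_Suc Suc_diff_Suc order_less_le_trans take_Suc_Cons)
      have "?p j = ?p i * prod_list (take (j - i) (drop i fs))"
        using ij by (metis le_add_diff_inverse less_imp_le prod_list.append take_add)
      then have "?p i * prod_list (take (j - i) (drop i fs)) dvd ?p i"
        using eq by (simp add: principal_eq_iff)
      moreover have "?p i \<noteq> 0"
        using p_dvd[of i] x by auto
      ultimately have "prod_list (take (j - i) (drop i fs)) \<in> units"
        using presimplifiable_dvd_mult[OF pres] by blast
      then have "fs ! i \<in> units"
        using nth by (metis list.set_intros(1) prod_list_in_units_imp)
      moreover have "fs ! i \<in> nonunits"
        using fs ij by (auto simp: factorizations_def)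
      ultimately show False
        by (simp add: nonunits_iff)
    qed
    have "inj_on (\<lambda>i. principal (?p i)) {..length fs}"
      by (rule inj_onI) (metis atMost_iff distinct linorder_neqE_nat)
    then have "card {..length fs} \<le> card ?D"
      by (rule card_inj_on_le) (use fin p_dvd in auto)
    then show ?thesis by simp
  qed
  then show "\<exists>N. \<forall>fs \<in> factorizations nonunits x. length fs \<le> N" by blast
qed

text \<open>
  In a factorization of maximal length no factor can be split further.
\<close>

lemma BFR_imp_has_atomic_factorizations:
  assumes BFR: "BFR TYPE('a::comm_ring_1)"
  shows "has_atomic_factorizations \<alpha> TYPE('a)"
  unfolding has_atomic_factorizations_def
proof (rule ballI)
  fix x :: 'a assume x: "x \<in> nonunits - {0}"
  obtain N where N: "\<And>fs. fs \<in> factorizations nonunits x \<Longrightarrow> length fs \<le> N"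
    using BFR x unfolding BFR_def by blast
  have "[x] \<in> factorizations nonunits x"
    using x by (simp add: factorizations_def)
  then obtain fs where fs: "fs \<in> factorizations nonunits x"
    and longest: "\<And>gs. gs \<in> factorizations nonunits x \<Longrightarrow> length gs \<le> length fs"
    using ex_has_greatest_nat[of "\<lambda>fs. fs \<in> factorizations nonunits x" "[x]" length "Suc N"] N
    by (metis less_Suc_eq_le)
  have "p \<in> atoms \<alpha>" if p: "p \<in> set fs" for p
  proof (rule unsplittable_imp_atom[OF BFR_imp_presimplifiable[OF BFR]])
    show "p \<in> nonunits"
      using fs p by (auto simp: factorizations_def)
    fix b c assume bc: "p = b * c"
    show "b \<in> units \<or> c \<in> units"
    proof (rule ccontr)
      assume neg: "\<not> (b \<in> units \<or> c \<in> units)"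
      obtain ys zs where "fs = ys @ p # zs"
        using split_list[OF p] by blast
      then have "ys @ b # c # zs \<in> factorizations nonunits x" "length (ys @ b # c # zs) > length fs"
        using fs neg bc by (auto simp: factorizations_def nonunits_iff mult.assoc)
      then show False
        using longest by fastforce
    qed
  qed
  then show "factorizations (atoms \<alpha>) x \<noteq> {}"
    using fs by (auto simp: factorizations_def)
qed


section \<open>Finite factorization rings\<close>

lemma FFR_imp_BFR:
  assumes "FFR \<beta> TYPE('a::comm_ring_1)"
  shows "BFR TYPE('a)"
  unfolding BFR_def
proof (rule ballI)
  fix x :: 'a assume "x \<in> nonunits - {0}"
  then obtain F where F: "finite F"
      "\<forall>fs \<in> factorizations nonunits x. \<exists>gs\<in>F. rel_mset (same \<beta>) (mset fs) (mset gs)"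
    using assms unfolding FFR_def finite_up_to_def by blast
  have "length fs \<le> Max (length ` F)" if fs: "fs \<in> factorizations nonunits x" for fs
  proof -
    obtain gs where "gs \<in> F" "rel_mset (same \<beta>) (mset fs) (mset gs)"
      using F(2) fs by blast
    then have "length fs = length gs" "length gs \<in> length ` F"
      using rel_mset_size by fastforce+
    then show ?thesis
      using F(1) by simp
  qed
  then show "\<exists>N. \<forall>fs \<in> factorizations nonunits x. length fs \<le> N" by blast
qed

text \<open>
  Apart from units and associates of \<open>x\<close>, every divisor of \<open>x\<close> is a factor in a factorization of
  length two. So up to associates it occurs in one of the finitely many representative ones.
\<close>

lemma FFR_imp_finite_divisors:
  assumes FFR: "FFR \<beta> TYPE('a::comm_ring_1)"
  shows "finitely_many_principal_divisors TYPE('a)"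
  unfolding finitely_many_principal_divisors_def
proof (intro conjI ballI)
  show pres: "presimplifiable TYPE('a)"
    using FFR FFR_imp_BFR BFR_imp_presimplifiable by blast
  fix x :: 'a assume "x \<in> nonunits - {0}"
  then obtain F where F: "finite F"
      "\<forall>fs \<in> factorizations nonunits x. \<exists>gs\<in>F. rel_mset (same \<beta>) (mset fs) (mset gs)"
    using FFR unfolding FFR_def finite_up_to_def by blast
  have "principal a \<in> principal ` ({1, x} \<union> \<Union>(set ` F))" if a: "a dvd x" for a
  proof -
    obtain b where x: "x = a * b"
      using a by (auto simp: dvd_def)
    consider "a \<in> units" | "b \<in> units" | "a \<in> nonunits" "b \<in> nonunits"
      using nonunits_iff by blast
    then show ?thesis
    proof cases
      case 1
      then have "principal a = principal 1"
        using principal_mult_unit[of a 1] by simp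
      then show ?thesis by blast
    next
      case 2
      then have "principal a = principal x"
        by (simp add: x principal_mult_unit)
      then show ?thesis by blast
    next
      case 3
      then have "[a, b] \<in> factorizations nonunits x"
        by (simp add: factorizations_def x)
      then obtain gs where gs: "gs \<in> F" "rel_mset (same \<beta>) (mset [a, b]) (mset gs)"
        using F(2) by blast
      then obtain M c where M: "mset gs = add_mset c M" and c: "same \<beta> a c"
        using msed_rel_invL[of "same \<beta>" a "{#b#}" "mset gs"] by auto
      have "c \<in> set gs"
        using arg_cong[OF M, of set_mset] by simp
      have "principal a = principal c"
        using same_imp_associates[OF c] by (simp add: associates_def)
      with \<open>c \<in> set gs\<close> gs(1) show ?thesis by blast
    qed
  qed
  then have "principal ` {a. a dvd x} \<subseteq> principal ` ({1, x} \<union> \<Union>(set ` F))"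
    by blast
  then show "finite (principal ` {a. a dvd x})"
    by (rule finite_subset) (use F(1) in simp)
qed

text \<open>
  Two factorizations that give the same list of principal ideals agree up to \<open>\<beta>\<close>, and there are only
  finitely many lists of bounded length over a finite set of ideals.
\<close>

lemma finite_divisors_imp_FFR:
  assumes fin: "finitely_many_principal_divisors TYPE('a::comm_ring_1)"
  shows "FFR \<beta> TYPE('a)"
  unfolding FFR_def
proof (rule ballI)
  have pres: "presimplifiable TYPE('a)"
    using fin by (simp add: finitely_many_principal_divisors_def)
  fix x :: 'a assume x: "x \<in> nonunits - {0}"
  obtain N where N: "\<And>fs. fs \<in> factorizations nonunits x \<Longrightarrow> length fs \<le> N"
    using finite_divisors_imp_BFR[OF fin] x unfolding BFR_def by blast
  show "finite_up_to (\<lambda>fs gs. rel_mset (same \<beta>) (mset fs) (mset gs)) (factorizations nonunits x)"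
  proof (rule finite_image_imp_finite_up_to)
    have "map principal ` factorizations nonunits x
        \<subseteq> {xs. set xs \<subseteq> principal ` {a. a dvd x} \<and> length xs \<le> N}"
      (is "_ \<subseteq> ?L")
    proof clarify
      fix fs assume fs: "fs \<in> factorizations nonunits x"
      then have "a dvd x" if "a \<in> set fs" for a
        using dvd_prod_list[OF that] by (simp add: factorizations_def)
      then show "set (map principal fs) \<subseteq> principal ` {a. a dvd x} \<and> length (map principal fs) \<le> N"
        using N[OF fs] by auto
    qed
    moreover have "finite ?L"
      using fin x by (intro finite_lists_length_le) (simp add: finitely_many_principal_divisors_def)
    ultimately show "finite (map principal ` factorizations nonunits x)"
      by (rule finite_subset)
  next
    fix fs gs :: "'a list" assume eq: "map principal fs = map principal gs"
    have "list_all2 (=) (map principal fs) (map principal gs)"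
      by (simp add: eq list.rel_eq)
    then have "list_all2 associates fs gs"
      by (simp add: list_all2_map1 list_all2_map2 associates_def[abs_def])
    then show "rel_mset (same \<beta>) (mset fs) (mset gs)"
      unfolding presimplifiable_same[OF pres] rel_mset_def by blast
  qed
qed


section \<open>Dickson's lemma\<close>

lemma nat_seq_has_mono_subseq:
  fixes s :: "nat \<Rightarrow> nat"
  shows "\<exists>r :: nat \<Rightarrow> nat. strict_mono r \<and> mono (\<lambda>n. s (r n))"
proof -
  obtain f :: "nat \<Rightarrow> nat" where f: "strict_mono f" "monoseq (\<lambda>n. s (f n))"
    using seq_monosub by blast
  show ?thesis
  proof (cases "mono (\<lambda>n. s (f n))")
    case False
    then have anti: "s (f n) \<le> s (f m)" if "m \<le> n" for m n
      using f(2) that by (auto simp: monoseq_def mono_def)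
    obtain k where k: "\<And>n. s (f k) \<le> s (f n)"
      using ex_has_least_nat[of "\<lambda>_. True" 0 "\<lambda>n. s (f n)"] by auto
    \<comment> \<open>A decreasing sequence of naturals is constant from the place on where it attains its minimum.\<close>
    have "s (f (k + n)) = s (f k)" for n
      using anti[of k "k + n"] k[of "k + n"] by simp
    then have "mono (\<lambda>n. s (f (k + n)))"
      by (simp add: mono_def)
    moreover have "strict_mono (\<lambda>n. f (k + n))"
      using f(1) by (simp add: strict_mono_def)
    ultimately show ?thesis
      by (intro exI[of _ "\<lambda>n. f (k + n)"] conjI)
  qed (use f in blast)
qed

lemma multiset_seq_has_mono_subseq:
  fixes f :: "nat \<Rightarrow> 'b multiset"
  assumes "finite A"
  shows "\<exists>r :: nat \<Rightarrow> nat. strict_mono r \<and> (\<forall>a\<in>A. mono (\<lambda>n. count (f (r n)) a))"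
  using assms
proof (induction A)
  case empty
  show ?case by (rule exI[of _ id]) (simp add: strict_mono_def)
next
  case (insert a A)
  then obtain r :: "nat \<Rightarrow> nat" where r: "strict_mono r" "\<forall>a\<in>A. mono (\<lambda>n. count (f (r n)) a)"
    by blast
  obtain q :: "nat \<Rightarrow> nat" where q: "strict_mono q" "mono (\<lambda>n. count (f (r (q n))) a)"
    using nat_seq_has_mono_subseq[of "\<lambda>n. count (f (r n)) a"] by blast
  have "strict_mono (\<lambda>n. r (q n))"
    using r(1) q(1) by (simp add: strict_mono_def)
  moreover have "mono (\<lambda>n. count (f (r (q n))) b)" if "b \<in> A" for b
    using r(2) that strict_mono_mono[OF q(1)] by (simp add: mono_def)
  ultimately show ?case
    using q(2) by blast
qed

lemma finite_multiset_antichain: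
  assumes "finite A" and sub: "\<And>m. m \<in> M \<Longrightarrow> set_mset m \<subseteq> A"
    and antichain: "\<And>m m'. m \<in> M \<Longrightarrow> m' \<in> M \<Longrightarrow> m \<subseteq># m' \<Longrightarrow> m = m'"
  shows "finite M"
proof (rule ccontr)
  assume "infinite M"
  then obtain f :: "nat \<Rightarrow> _" where f: "inj f" "range f \<subseteq> M"
    using infinite_countable_subset by blast
  obtain r :: "nat \<Rightarrow> nat" where r: "strict_mono r" "\<forall>a\<in>A. mono (\<lambda>n. count (f (r n)) a)"
    using multiset_seq_has_mono_subseq[OF \<open>finite A\<close>] by blast
  have "count (f (r 0)) a \<le> count (f (r 1)) a" for a
  proof (cases "a \<in> A")
    case True
    then show ?thesis using r(2) by (auto simp: mono_def)
  next
    case False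
    then have "a \<notin># f (r 0)"
      using sub[of "f (r 0)"] f(2) by auto
    then show ?thesis by (simp add: not_in_iff)
  qed
  then have "f (r 0) \<subseteq># f (r 1)"
    by (simp add: subseteq_mset_def)
  then have "f (r 0) = f (r 1)"
    using f(2) by (intro antichain) auto
  then have "r 0 = r 1"
    using f(1) by (simp add: inj_eq)
  moreover have "r 0 < r 1"
    using r(1) by (simp add: strict_mono_def)
  ultimately show False by simp
qed


section \<open>Rings with finitely many atomic divisors\<close>

text \<open>
  The representing factorizations of \<open>x\<close> are multisets over a finite set \<open>F\<close> of non-units. If one is
  contained in another, both products are associates of \<open>x\<close>, so by presimplifiability the difference
  has a unit as its product and is empty.
\<close>

lemma finite_factorizations_over_finite_set:
  fixes x :: "'a::comm_ring_1"
  assumes pres: "presimplifiable TYPE('a)" and "x \<noteq> 0" and F: "finite F" "F \<subseteq> nonunits"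
  shows "finite {m. set_mset m \<subseteq> F \<and> principal (prod_mset m) = principal x}"
proof (rule finite_multiset_antichain[OF F(1)])
  fix m m'
  assume m: "m \<in> {m. set_mset m \<subseteq> F \<and> principal (prod_mset m) = principal x}"
    and m': "m' \<in> {m. set_mset m \<subseteq> F \<and> principal (prod_mset m) = principal x}"
    and sub: "m \<subseteq># m'"
  define d where "d = m' - m"
  have m'_eq: "m' = m + d"
    unfolding d_def by (rule subset_mset.add_diff_inverse[OF sub, symmetric])
  have "prod_mset m' dvd x" "x dvd prod_mset m"
    using m m' by (simp_all add: principal_eq_iff)
  then have "prod_mset m * prod_mset d dvd prod_mset m"
    using dvd_trans[of "prod_mset m'" x "prod_mset m"] by (simp add: m'_eq)
  moreover have "prod_mset m \<noteq> 0"
    using m \<open>x \<noteq> 0\<close> by (auto simp: principal_eq_iff)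
  ultimately have d_unit: "prod_mset d \<in> units"
    by (rule presimplifiable_dvd_mult[OF pres])
  have "p \<in> units" if "p \<in># d" for p
    using dvd_trans[OF dvd_prod_mset[OF that]] d_unit by (simp add: units_def)
  moreover have "p \<in> nonunits" if "p \<in># d" for p
    using that m' F(2) by (auto simp: m'_eq)
  ultimately have "d = {#}"
    by (metis multiset_nonemptyE nonunits_iff)
  then show "m = m'"
    by (simp add: m'_eq)
qed auto

lemma atomic_divisor_finite_imp_finite_divisors:
  assumes pres: "presimplifiable TYPE('a::comm_ring_1)"
    and atomic: "has_atomic_factorizations \<alpha> TYPE('a)"
    and df: "divisor_finite \<alpha> \<beta> TYPE('a)"
  shows "finitely_many_principal_divisors TYPE('a)"
  unfolding finitely_many_principal_divisors_def
proof (intro conjI ballI)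
  fix x :: 'a assume x: "x \<in> nonunits - {0}"
  obtain F where F: "F \<subseteq> {a \<in> atoms \<alpha>. a dvd x}" "finite F"
      "\<And>a. a \<in> atoms \<alpha> \<Longrightarrow> a dvd x \<Longrightarrow> \<exists>p\<in>F. principal a = principal p"
  proof -
    have "finite_up_to associates {a \<in> atoms \<alpha>. a dvd x}"
      using df x by (simp add: divisor_finite_def presimplifiable_same[OF pres])
    then show ?thesis
      using that unfolding finite_up_to_def associates_def by blast
  qed
  have F_nonunits: "F \<subseteq> nonunits"
    using F(1) atoms_subset_nonunits by blast
  have represent: "\<exists>ps. set ps \<subseteq> F \<and> principal (prod_list ps) = principal (prod_list fs)"
    if "set fs \<subseteq> {a \<in> atoms \<alpha>. a dvd x}" for fs
    using that
  proof (induction fs)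
    case Nil
    show ?case by (rule exI[of _ "[]"]) simp
  next
    case (Cons a fs)
    then obtain ps where ps: "set ps \<subseteq> F" "principal (prod_list ps) = principal (prod_list fs)"
      by auto
    obtain p where p: "p \<in> F" "principal a = principal p"
      using F(3)[of a] Cons.prems by auto
    have "set (p # ps) \<subseteq> F" "principal (prod_list (p # ps)) = principal (prod_list (a # fs))"
      using ps p principal_mult_cong[of p a] by auto
    then show ?case by blast
  qed
  have divisor: "\<exists>ps. set ps \<subseteq> F \<and> principal (prod_list ps) = principal a" if a: "a dvd x" for a
  proof (cases "a \<in> units")
    case True
    then have "principal (prod_list []) = principal a"
      using principal_mult_unit[of a 1] by simp
    then show ?thesis by (metis empty_set empty_subsetI)
  next
    case False
    then have "a \<in> nonunits - {0}"
      using a x by (auto simp: nonunits_iff)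
    then obtain fs where fs: "set fs \<subseteq> atoms \<alpha>" "prod_list fs = a"
      using atomic unfolding has_atomic_factorizations_def factorizations_def by blast
    have "p dvd x" if "p \<in> set fs" for p
      using dvd_trans[OF dvd_prod_list[OF that]] fs(2) a by simp
    with fs(1) have "set fs \<subseteq> {a \<in> atoms \<alpha>. a dvd x}" by blast
    with represent fs(2) show ?thesis by blast
  qed
  let ?M = "{m. set_mset m \<subseteq> F \<and> principal (prod_mset m) = principal x}"
  have "finite ?M"
    using finite_factorizations_over_finite_set[OF pres _ F(2) F_nonunits] x by blast
  then obtain N where "\<forall>n \<in> size ` ?M. n \<le> N"
    using finite_nat_set_iff_bounded_le[of "size ` ?M"] by auto
  then have N: "\<And>m. m \<in> ?M \<Longrightarrow> size m \<le> N" by blast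
  have "principal a \<in> (\<lambda>ps. principal (prod_list ps)) ` {ps. set ps \<subseteq> F \<and> length ps \<le> N}"
    if a: "a dvd x" for a
  proof -
    obtain b where b: "x = a * b"
      using a by (auto simp: dvd_def)
    obtain ps where ps: "set ps \<subseteq> F" "principal (prod_list ps) = principal a"
      using divisor[OF a] by blast
    obtain qs where qs: "set qs \<subseteq> F" "principal (prod_list qs) = principal b"
      using divisor[of b] b by auto
    have "mset (ps @ qs) \<in> ?M"
      using ps qs principal_mult_cong[OF ps(2) qs(2)] by (simp add: b prod_mset_prod_list)
    then have "length ps \<le> N"
      using N[of "mset (ps @ qs)"] by simp
    with ps show ?thesis
      by (intro image_eqI[of _ _ ps]) simp_all
  qed
  then have "principal ` {a. a dvd x}
      \<subseteq> (\<lambda>ps. principal (prod_list ps)) ` {ps. set ps \<subseteq> F \<and> length ps \<le> N}"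
    by blast
  then show "finite (principal ` {a. a dvd x})"
    by (rule finite_subset) (intro finite_imageI finite_lists_length_le F(2))
qed (fact pres)


section \<open>Divisor graphs\<close>

lemma loops_nonzero:
  assumes u: "u \<in> units" and fact: "a # a # as \<in> factorizations A (u * x)"
  shows "loops A x a \<noteq> 0"
proof (cases "\<forall>N. \<exists>n\<ge>N. a ^ n dvd x")
  case True
  then show ?thesis by (simp add: loops_def)
next
  case False
  let ?K = "{n. \<exists>u\<in>units. \<exists>as. replicate n a @ as \<in> factorizations A (u * x)}"
  obtain N where N: "\<And>n. n \<ge> N \<Longrightarrow> \<not> a ^ n dvd x"
    using False by blast
  have "n < N" if n: "n \<in> ?K" for n
  proof -
    obtain u as where "u \<in> units" and "replicate n a @ as \<in> factorizations A (u * x)"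
      using n by blast
    then have "u dvd 1" and "a ^ n * prod_list as = u * x"
      by (auto simp: units_def factorizations_def)
    then have "a ^ n dvd u * x"
      by (metis dvd_triv_left)
    also have "u * x dvd x"
      using mult_dvd_mono[OF \<open>u dvd 1\<close> dvd_refl[of x]] by simp
    finally have "a ^ n dvd x" .
    then show "n < N"
      using N not_le by blast
  qed
  then have "bdd_above ?K"
    by (intro bdd_aboveI[of _ N] less_imp_le)
  moreover have "2 \<in> ?K"
    using u fact by (auto simp: numeral_2_eq_2 intro!: bexI[of _ u] exI[of _ as])
  ultimately have "2 \<le> Sup ?K"
    by (rule cSup_upper[rotated])
  then show ?thesis
    using False by (simp add: loops_def zero_enat_def)
qed

text \<open>
  If \<open>x = a * b\<close> with a non-unit \<open>b\<close>, the representative \<open>s\<close> of \<open>b\<close> is a neighbour of \<open>a\<close>, or \<open>s = a\<close>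
  and \<open>a\<close> has a loop. As only \<open>b = s * t\<close> is known, the cofactor \<open>t\<close> either becomes a factor or
  is moved into the unit of the factorization.
\<close>

lemma adjacent_or_loop:
  assumes S: "representatives \<beta> nonunits S" and a: "a \<in> vertices S x" and "\<not> x dvd a"
  shows "(\<exists>b. adjacent nonunits S x a b) \<or> loops nonunits x a \<noteq> 0"
proof -
  obtain b where b: "x = a * b"
    using a by (auto simp: vertices_def dvd_def)
  have "b \<in> nonunits"
    using \<open>\<not> x dvd a\<close> principal_mult_unit[of b a] by (auto simp: b nonunits_iff principal_eq_iff)
  then obtain s where s: "s \<in> S" "same \<beta> b s"
    using S unfolding representatives_def by blast
  obtain t where t: "b = s * t"
    using associates_imp_dvd[OF same_imp_associates[OF s(2)]] by (auto simp: dvd_def)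
  have nonunits: "a \<in> nonunits" "s \<in> nonunits"
    using S a s(1) by (auto simp: vertices_def representatives_def)
  have fact: "\<exists>u\<in>units. \<exists>as. a # s # as \<in> factorizations nonunits (u * x)"
  proof (cases "t \<in> units")
    case True
    then obtain u where u: "t * u = 1"
      unfolding units_def by (metis dvdE mem_Collect_eq)
    have "u * x = a * s * (t * u)"
      by (simp add: b t ac_simps)
    then have "[a, s] \<in> factorizations nonunits (u * x)"
      using nonunits by (simp add: factorizations_def u)
    moreover have "u \<in> units"
      using u units_mult_iff one_in_units by metis
    ultimately show ?thesis by blast
  next
    case False
    then have "[a, s, t] \<in> factorizations nonunits (1 * x)"
      using nonunits by (simp add: factorizations_def nonunits_iff b t)
    then show ?thesis
      using one_in_units by blast
  qed
  show ?thesis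
  proof (cases "s = a")
    case True
    with fact show ?thesis
      using loops_nonzero by blast
  next
    case False
    have "s \<in> vertices S x"
      using s(1) by (simp add: vertices_def b t)
    with False fact a show ?thesis
      unfolding adjacent_def by blast
  qed
qed

text \<open>
  This turns a failure of presimplifiability into a vertex that violates any finiteness condition
  on loops.
\<close>

lemma infinitely_many_loops:
  assumes S: "representatives \<beta> nonunits (S :: 'a::comm_ring_1 set)"
    and "\<not> presimplifiable TYPE('a)"
  shows "\<exists>x \<in> nonunits - {0 :: 'a}. \<exists>a \<in> vertices S x. loops A x a = \<infinity>"
proof -
  obtain x y :: 'a where xy: "x = x * y" "x \<noteq> 0" "y \<notin> units"
    using assms(2) unfolding presimplifiable_def by blast
  have "y \<in> nonunits"
    using xy(3) by (simp add: nonunits_iff)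
  then obtain s where s: "s \<in> S" "same \<beta> y s"
    using S unfolding representatives_def by blast
  have "s dvd y"
    using associates_imp_dvd[OF same_imp_associates[OF s(2)]] by blast
  have pow: "s ^ n dvd x" for n
  proof -
    have "x * y ^ n = x"
      using xy(1) by (induction n) (auto simp: mult.assoc[symmetric])
    moreover have "s ^ n dvd x * y ^ n"
      by (intro dvd_mult dvd_power_same \<open>s dvd y\<close>)
    ultimately show ?thesis by simp
  qed
  have "x \<in> nonunits"
    using xy units_mult_iff nonunits_iff by metis
  moreover have "s \<in> vertices S x"
    using pow[of 1] s(1) by (simp add: vertices_def)
  moreover have "loops A x s = \<infinity>"
    using pow by (auto simp: loops_def)
  ultimately show ?thesis
    using xy(2) by blast
qed

text \<open>
  In a presimplifiable ring at most one vertex, the representative of \<open>x\<close>, is isolated and without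
  loops.
\<close>

lemma finite_vertices_if_finite_nonisolated:
  assumes pres: "presimplifiable TYPE('a::comm_ring_1)"
    and S: "representatives \<beta> nonunits (S :: 'a set)"
    and fin: "finite {a \<in> vertices S x. (\<exists>b. adjacent nonunits S x a b) \<or> loops nonunits x a \<noteq> 0}"
      (is "finite ?V")
  shows "finite (vertices S x)"
proof -
  have "principal ` {a \<in> vertices S x. x dvd a} \<subseteq> {principal x}"
    by (simp add: vertices_def principal_eq_iff image_subset_iff)
  then have "finite (principal ` {a \<in> vertices S x. x dvd a})"
    using finite_subset by blast
  moreover have "inj_on principal {a \<in> vertices S x. x dvd a}"
    by (rule inj_on_subset[OF inj_on_principal_vertices[OF pres S]]) auto
  ultimately have "finite {a \<in> vertices S x. x dvd a}"
    using finite_image_iff by blast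
  moreover have "vertices S x \<subseteq> ?V \<union> {a \<in> vertices S x. x dvd a}"
    using adjacent_or_loop[OF S] by blast
  ultimately show ?thesis
    using fin finite_subset by blast
qed

lemma BFR_imp_finite_loops:
  assumes "BFR TYPE('a::comm_ring_1)" "(x :: 'a) \<in> nonunits - {0}" "a \<in> nonunits"
  shows "loops A x a \<noteq> \<infinity>"
proof -
  obtain N where N: "\<And>fs. fs \<in> factorizations nonunits x \<Longrightarrow> length fs \<le> N"
    using assms(1,2) unfolding BFR_def by blast
  have "n \<le> N" if "Suc n \<le> k" "a ^ k dvd x" for n k
  proof -
    have "a * a ^ n dvd x"
      using that by (metis dvd_trans le_imp_power_dvd power_Suc)
    then obtain t where t: "x = a * a ^ n * t"
      by (auto simp: dvd_def)
    \<comment> \<open>One copy of \<open>a\<close> absorbs the cofactor \<open>t\<close>, which may be a unit.\<close>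
    have "(a * t) # replicate n a \<in> factorizations nonunits x"
      using assms(3)
      by (auto simp: factorizations_def nonunits_iff units_mult_iff t ac_simps set_replicate_conv_if)
    then show "n \<le> N"
      using N by fastforce
  qed
  from this[of "Suc N"] have "\<not> (\<exists>k \<ge> Suc (Suc N). a ^ k dvd x)" by force
  then have "\<not> (\<forall>N. \<exists>n\<ge>N. a ^ n dvd x)" by blast
  then show ?thesis
    by (simp add: loops_def)
qed

lemma infsum_ennreal_finite_imp_finite_ge_1:
  fixes f :: "'b \<Rightarrow> ennreal"
  assumes "infsum f A < \<infinity>"
  shows "finite {a \<in> A. 1 \<le> f a}"
proof (rule ccontr)
  assume "infinite {a \<in> A. 1 \<le> f a}"
  then have "infsum f {a \<in> A. 1 \<le> f a} = \<infinity>"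
    by (intro infsum_superconst_infinite_ennreal[of _ 1]) auto
  moreover have "infsum f {a \<in> A. 1 \<le> f a} \<le> infsum f A"
    by (intro infsum_mono_neutral nonneg_summable_on_complete) auto
  ultimately show False
    using assms by (simp add: top_unique)
qed

lemma infsum_ennreal_finite_imp_finite_value:
  fixes f :: "'b \<Rightarrow> ennreal"
  assumes "infsum f A < \<infinity>" "a \<in> A"
  shows "f a < \<infinity>"
proof -
  have "infsum f {a} \<le> infsum f A"
    using assms(2) by (intro infsum_mono_neutral nonneg_summable_on_complete) auto
  then show ?thesis
    using assms(1) by (simp add: order_le_less_trans)
qed

lemma degl_ge_1:
  assumes "(\<exists>b. adjacent A S x a b) \<or> loops A x a \<noteq> 0"
  shows "1 \<le> degl A S x a"
proof -
  have "deg A S x a \<noteq> 0" if "\<exists>b. adjacent A S x a b"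
    using that by (auto simp: deg_def Let_def zero_enat_def)
  with assms have "degl A S x a \<noteq> 0"
    by (auto simp: degl_def)
  then show ?thesis
    by (simp add: ileI1 one_eSuc zero_less_iff_neq_zero)
qed

lemma degree_sums_finite_iff:
  assumes S: "representatives \<beta> nonunits (S :: 'a::comm_ring_1 set)"
  shows "(\<forall>x \<in> nonunits - {0}.
      (\<Sum>\<^sub>\<infinity>a \<in> vertices S x. ennreal_of_enat (degl nonunits S x a)) < \<infinity>)
    \<longleftrightarrow> finitely_many_principal_divisors TYPE('a)"
    (is "(\<forall>x \<in> _. infsum (?f x) _ < \<infinity>) \<longleftrightarrow> _")
proof
  assume sums: "\<forall>x \<in> nonunits - {0}. infsum (?f x) (vertices S x) < \<infinity>"
  have pres: "presimplifiable TYPE('a)"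
  proof (rule ccontr)
    assume "\<not> presimplifiable TYPE('a)"
    then obtain x a where xa: "x \<in> nonunits - {0 :: 'a}" "a \<in> vertices S x" "loops nonunits x a = \<infinity>"
      using infinitely_many_loops[OF S] by blast
    then have "?f x a = \<infinity>"
      by (simp add: degl_def)
    moreover have "?f x a < \<infinity>"
      using infsum_ennreal_finite_imp_finite_value[of "?f x"] sums xa(1,2) by blast
    ultimately show False by simp
  qed
  have "finite (vertices S x)" if x: "x \<in> nonunits - {0}" for x
  proof (rule finite_vertices_if_finite_nonisolated[OF pres S])
    have "1 \<le> ?f x a" if "(\<exists>b. adjacent nonunits S x a b) \<or> loops nonunits x a \<noteq> 0" for a
      using degl_ge_1[OF that] by (metis ennreal_of_enat_1 ennreal_of_enat_le_iff)
    then have "{a \<in> vertices S x. (\<exists>b. adjacent nonunits S x a b) \<or> loops nonunits x a \<noteq> 0}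
        \<subseteq> {a \<in> vertices S x. 1 \<le> ?f x a}"
      by blast
    moreover have "finite {a \<in> vertices S x. 1 \<le> ?f x a}"
      using infsum_ennreal_finite_imp_finite_ge_1 sums x by blast
    ultimately show "finite {a \<in> vertices S x.
        (\<exists>b. adjacent nonunits S x a b) \<or> loops nonunits x a \<noteq> 0}"
      by (rule finite_subset)
  qed
  then show "finitely_many_principal_divisors TYPE('a)"
    using finite_nonunit_vertices_iff_finite_divisors[OF pres S] by blast
next
  assume fin: "finitely_many_principal_divisors TYPE('a)"
  then have pres: "presimplifiable TYPE('a)"
    by (simp add: finitely_many_principal_divisors_def)
  show "\<forall>x \<in> nonunits - {0}. infsum (?f x) (vertices S x) < \<infinity>"
  proof
    fix x :: 'a assume x: "x \<in> nonunits - {0}"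
    have V: "finite (vertices S x)"
      using finite_nonunit_vertices_iff_finite_divisors[OF pres S] fin x by blast
    have "?f x a < \<infinity>" if a: "a \<in> vertices S x" for a
    proof -
      have "finite {b. adjacent nonunits S x a b}"
        using V by (rule rev_finite_subset) (auto simp: adjacent_def)
      then have "deg nonunits S x a \<noteq> \<infinity>"
        by (simp add: deg_def)
      moreover have "loops nonunits x a \<noteq> \<infinity>"
        using BFR_imp_finite_loops[OF finite_divisors_imp_BFR[OF fin] x] a S
        by (auto simp: vertices_def representatives_def)
      ultimately obtain n where "degl nonunits S x a = enat n"
        by (auto simp: degl_def)
      then show ?thesis
        by (simp add: of_nat_less_top)
    qed
    with V show "infsum (?f x) (vertices S x) < \<infinity>"
      by (simp del: sum_ennreal_of_enat)
  qed
qed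

lemma edges_finite_iff:
  assumes S: "representatives \<beta> nonunits (S :: 'a::comm_ring_1 set)"
  shows "(\<forall>x \<in> nonunits - {0}. finite (edges nonunits S x))
    \<longleftrightarrow> finitely_many_principal_divisors TYPE('a)"
proof
  assume edges: "\<forall>x \<in> nonunits - {0}. finite (edges nonunits S x)"
  have pres: "presimplifiable TYPE('a)"
  proof (rule ccontr)
    assume "\<not> presimplifiable TYPE('a)"
    then obtain x a where xa: "x \<in> nonunits - {0 :: 'a}" "a \<in> vertices S x" "loops nonunits x a = \<infinity>"
      using infinitely_many_loops[OF S] by blast
    then have "range (Loop a) \<subseteq> edges nonunits S x"
      by (auto simp: edges_def)
    moreover have "infinite (range (Loop a))"
      by (intro range_inj_infinite injI) simp
    ultimately show False
      using edges xa(1) finite_subset by blast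
  qed
  have "finite (vertices S x)" if x: "x \<in> nonunits - {0}" for x
  proof (rule finite_vertices_if_finite_nonisolated[OF pres S])
    let ?ends = "\<lambda>e. case e of Edge ab \<Rightarrow> ab | Loop a k \<Rightarrow> {a}"
    let ?V = "{a \<in> vertices S x. (\<exists>b. adjacent nonunits S x a b) \<or> loops nonunits x a \<noteq> 0}"
    have "?V \<subseteq> \<Union>(?ends ` edges nonunits S x)"
    proof
      fix a assume a: "a \<in> ?V"
      then consider b where "adjacent nonunits S x a b" | "loops nonunits x a \<noteq> 0" by blast
      then show "a \<in> \<Union>(?ends ` edges nonunits S x)"
      proof cases
        case 1
        then have "Edge {a, b} \<in> edges nonunits S x"
          by (auto simp: edges_def)
        then show ?thesis by force
      next
        case 2
        then have "Loop a 0 \<in> edges nonunits S x"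
          using a by (auto simp: edges_def zero_enat_def[symmetric] zero_less_iff_neq_zero)
        then show ?thesis by force
      qed
    qed
    moreover have "finite (\<Union>(?ends ` edges nonunits S x))"
      using edges x by (intro finite_Union finite_imageI) (auto simp: edges_def)
    ultimately show "finite ?V"
      by (rule finite_subset)
  qed
  then show "finitely_many_principal_divisors TYPE('a)"
    using finite_nonunit_vertices_iff_finite_divisors[OF pres S] by blast
next
  assume fin: "finitely_many_principal_divisors TYPE('a)"
  then have pres: "presimplifiable TYPE('a)"
    by (simp add: finitely_many_principal_divisors_def)
  show "\<forall>x \<in> nonunits - {0}. finite (edges nonunits S x)"
  proof
    fix x :: 'a assume x: "x \<in> nonunits - {0}"
    let ?V = "vertices S x"
    have V: "finite ?V"
      using finite_nonunit_vertices_iff_finite_divisors[OF pres S] fin x by blast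
    have "finite {k. enat k < loops nonunits x a}" if a: "a \<in> ?V" for a
    proof -
      have "loops nonunits x a \<noteq> \<infinity>"
        using BFR_imp_finite_loops[OF finite_divisors_imp_BFR[OF fin] x] a S
        by (auto simp: vertices_def representatives_def)
      then show ?thesis by auto
    qed
    then have "finite (\<Union>a\<in>?V. Loop a ` {k. enat k < loops nonunits x a})"
      using V by blast
    moreover have "finite (Edge ` Pow ?V)"
      using V by simp
    moreover have "edges nonunits S x
        \<subseteq> Edge ` Pow ?V \<union> (\<Union>a\<in>?V. Loop a ` {k. enat k < loops nonunits x a})"
      by (auto simp: edges_def adjacent_def)
    ultimately show "finite (edges nonunits S x)"
      using finite_subset by blast
  qed
qed


section \<open>The equivalence\<close>

lemma WFFR_and_presimplifiable_iff:
  "presimplifiable TYPE('a::comm_ring_1) \<and> WFFR \<beta> TYPE('a)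
    \<longleftrightarrow> finitely_many_principal_divisors TYPE('a)"
  using WFFR_iff_finite_divisors finitely_many_principal_divisors_def by blast

lemma divisor_finite_and_presimplifiable_iff:
  "presimplifiable TYPE('a::comm_ring_1) \<and> has_atomic_factorizations \<alpha> TYPE('a)
      \<and> divisor_finite \<alpha> \<beta> TYPE('a)
    \<longleftrightarrow> finitely_many_principal_divisors TYPE('a)"
proof (intro iffI conjI)
  assume fin: "finitely_many_principal_divisors TYPE('a)"
  show pres: "presimplifiable TYPE('a)"
    using fin by (simp add: finitely_many_principal_divisors_def)
  show "has_atomic_factorizations \<alpha> TYPE('a)"
    using fin finite_divisors_imp_BFR BFR_imp_has_atomic_factorizations by blast
  show "divisor_finite \<alpha> \<beta> TYPE('a)"
    unfolding divisor_finite_iff[OF pres]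
  proof
    fix x :: 'a assume "x \<in> nonunits - {0}"
    then have "finite (principal ` {a. a dvd x})"
      using fin by (simp add: finitely_many_principal_divisors_def)
    then show "finite (principal ` {a \<in> atoms \<alpha>. a dvd x})"
      by (rule rev_finite_subset) auto
  qed
qed (use atomic_divisor_finite_imp_finite_divisors in blast)

theorem theorem5p11:
  fixes \<alpha> \<alpha>' :: atom_kind and \<beta> \<beta>' :: assoc_kind
    and S T S' T' :: "'a::comm_ring_1 set"
  defines "conditions \<equiv> \<lambda>\<alpha> \<beta> (S :: 'a set) (T :: 'a set).
    [FFR \<beta> TYPE('a),
     BFR TYPE('a) \<and> WFFR \<beta> TYPE('a),
     presimplifiable TYPE('a) \<and> WFFR \<beta> TYPE('a),
     BFR TYPE('a) \<and> divisor_finite \<alpha> \<beta> TYPE('a),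
     presimplifiable TYPE('a) \<and> has_atomic_factorizations \<alpha> TYPE('a)
       \<and> divisor_finite \<alpha> \<beta> TYPE('a),
     \<forall>x \<in> nonunits - {0}.
       (\<Sum>\<^sub>\<infinity>a \<in> vertices S x. ennreal_of_enat (degl nonunits S x a)) < \<infinity>,
     \<forall>x \<in> nonunits - {0}. finite (edges nonunits S x),
     BFR TYPE('a) \<and> (\<forall>x \<in> nonunits - {0}. finite (vertices S x)),
     presimplifiable TYPE('a) \<and> (\<forall>x \<in> nonunits - {0}. finite (vertices S x)),
     BFR TYPE('a) \<and> (\<forall>x \<in> nonunits - {0}. finite (vertices T x)),
     presimplifiable TYPE('a) \<and> has_atomic_factorizations \<alpha> TYPE('a)
       \<and> (\<forall>x \<in> nonunits - {0}. finite (vertices T x))]"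
  assumes "representatives \<beta> nonunits S" and "representatives \<beta> (atoms \<alpha>) T"
    and "representatives \<beta>' nonunits S'" and "representatives \<beta>' (atoms \<alpha>') T'"
  shows "\<forall>P \<in> set (conditions \<alpha> \<beta> S T). \<forall>Q \<in> set (conditions \<alpha>' \<beta>' S' T'). P \<longleftrightarrow> Q"
proof -
  let ?fin = "finitely_many_principal_divisors TYPE('a)"
  have equiv: "\<forall>P \<in> set (conditions \<alpha> \<beta> S T). P \<longleftrightarrow> ?fin"
    if S: "representatives \<beta> nonunits S" and T: "representatives \<beta> (atoms \<alpha>) T" for \<alpha> \<beta> S T
  proof -
    have BFR: "?fin \<Longrightarrow> BFR TYPE('a)"
      by (rule finite_divisors_imp_BFR)
    have pres: "BFR TYPE('a) \<Longrightarrow> presimplifiable TYPE('a)"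
      by (rule BFR_imp_presimplifiable)
    have pres_fin: "?fin \<Longrightarrow> presimplifiable TYPE('a)"
      using BFR pres by blast
    have "FFR \<beta> TYPE('a) \<longleftrightarrow> ?fin"
      using FFR_imp_finite_divisors finite_divisors_imp_FFR by blast
    moreover note WFFR = WFFR_and_presimplifiable_iff[where 'a='a, of \<beta>]
    moreover have "BFR TYPE('a) \<and> WFFR \<beta> TYPE('a) \<longleftrightarrow> ?fin"
      using WFFR BFR pres by blast
    moreover note df = divisor_finite_and_presimplifiable_iff[where 'a='a, of \<alpha> \<beta>]
    moreover have df_BFR: "BFR TYPE('a) \<and> divisor_finite \<alpha> \<beta> TYPE('a) \<longleftrightarrow> ?fin"
      using df BFR pres BFR_imp_has_atomic_factorizations by blast
    moreover note degree_sums_finite_iff[OF S] edges_finite_iff[OF S]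
    moreover have "BFR TYPE('a) \<and> (\<forall>x \<in> nonunits - {0}. finite (vertices S x)) \<longleftrightarrow> ?fin"
      using finite_nonunit_vertices_iff_finite_divisors[OF _ S] BFR pres by blast
    moreover have "presimplifiable TYPE('a) \<and> (\<forall>x \<in> nonunits - {0}. finite (vertices S x)) \<longleftrightarrow> ?fin"
      using finite_nonunit_vertices_iff_finite_divisors[OF _ S] pres_fin by blast
    moreover have "BFR TYPE('a) \<and> (\<forall>x \<in> nonunits - {0}. finite (vertices T x)) \<longleftrightarrow> ?fin"
      using finite_atom_vertices_iff_divisor_finite[OF _ T] df_BFR pres by blast
    moreover have "presimplifiable TYPE('a) \<and> has_atomic_factorizations \<alpha> TYPE('a)
        \<and> (\<forall>x \<in> nonunits - {0}. finite (vertices T x)) \<longleftrightarrow> ?fin"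
      using finite_atom_vertices_iff_divisor_finite[OF _ T] df by blast
    ultimately show ?thesis
      unfolding conditions_def by (simp only: list.set ball_simps simp_thms)
  qed
  show ?thesis
    using equiv[OF assms(2,3)] equiv[OF assms(4,5)] by blast
qed

end
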